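(* There exists a closed subspace $Z$ of $C[0,1]$ that is isomorphic to $c_0$ (as a Banach space, i.e., linearly homeomorphic) and is not poor in $C[0,1]$.
   Context: $C[0,1]$ is the real Banach space of continuous functions on $[0,1]$ with the supremum norm, and $c_0$ is the real Banach space of null sequences with the supremum norm. A normed space $X$ has the Daugavet property if $\|\mathrm{Id} + T\| = 1 + \|T\|$ for every (bounded linear) rank-one operator $T \colon X \to X$; $C[0,1]$ has the Daugavet property. For a Banach space $X$ with the Daugavet property, a closed subspace $Z \subset X$ is called poor if $X/\tilde{Z}$ (with the quotient norm) has the Daugavet property for every closed subspace $\tilde{Z} \subset Z$. *)

theory Defs
  imports "HOL-Analysis.Analysis"
begin

section \<open>The spaces \<open>C[0,1]\<close> and \<open>c\<^sub>0\<close>\<close>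

typedef unit_interval = "{0..1::real}"
  morphisms real_of_ui ui_of_real
  by auto

instantiation unit_interval :: metric_space
begin

definition dist_unit_interval :: "unit_interval \<Rightarrow> unit_interval \<Rightarrow> real"
  where "dist_unit_interval s t = dist (real_of_ui s) (real_of_ui t)"

definition uniformity_unit_interval :: "(unit_interval \<times> unit_interval) filter"
  where "uniformity_unit_interval = (INF e\<in>{0<..}. principal {(s, t). dist s t < e})"

definition open_unit_interval :: "unit_interval set \<Rightarrow> bool"
  where "open_unit_interval U = (\<forall>s\<in>U. \<forall>\<^sub>F (s', t) in uniformity. s' = s \<longrightarrow> t \<in> U)"

instance
proof
  fix s t u :: unit_interval
  show "dist s t = 0 \<longleftrightarrow> s = t"
    by (simp add: dist_unit_interval_def real_of_ui_inject)
  show "dist s t \<le> dist s u + dist t u"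
    unfolding dist_unit_interval_def by (rule dist_triangle2)
qed (rule uniformity_unit_interval_def open_unit_interval_def)+

end

lemma continuous_on_real_of_ui: "continuous_on UNIV real_of_ui"
  by (auto simp: continuous_on_iff dist_unit_interval_def)

lemma continuous_on_ui_of_real: "continuous_on {0..1} ui_of_real"
  by (auto simp: continuous_on_iff dist_unit_interval_def ui_of_real_inverse)

lemma compact_UNIV_unit_interval: "compact (UNIV :: unit_interval set)"
proof -
  have "UNIV = ui_of_real ` {0..1}"
    by (metis UNIV_eq_I imageI real_of_ui real_of_ui_inverse)
  then show ?thesis
    using compact_continuous_image[OF continuous_on_ui_of_real] by simp
qed

text \<open>
  \<open>C[0,1]\<close> with the supremum norm is the type \<^typ>\<open>unit_interval \<Rightarrow>\<^sub>C real\<close> of bounded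
  continuous functions: boundedness is automatic on a compact space.
\<close>

type_synonym C01 = "unit_interval \<Rightarrow>\<^sub>C real"

lemma bcontfun_unit_interval_iff:
  fixes f :: "unit_interval \<Rightarrow> real"
  shows "f \<in> bcontfun \<longleftrightarrow> continuous_on {0..1} (\<lambda>x. f (ui_of_real x))"
proof
  assume "f \<in> bcontfun"
  then have "continuous_on (ui_of_real ` {0..1}) f"
    by (auto simp: bcontfun_def intro: continuous_on_subset)
  then show "continuous_on {0..1} (\<lambda>x. f (ui_of_real x))"
    by (rule continuous_on_compose2[OF _ continuous_on_ui_of_real]) auto
next
  assume "continuous_on {0..1} (\<lambda>x. f (ui_of_real x))"
  then have "continuous_on UNIV (\<lambda>s. f (ui_of_real (real_of_ui s)))"
    by (rule continuous_on_compose2[OF _ continuous_on_real_of_ui]) (use real_of_ui in auto)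
  then have f: "continuous_on UNIV f"
    by (simp add: real_of_ui_inverse)
  moreover have "bounded (range f)"
    using compact_continuous_image[OF f compact_UNIV_unit_interval] by (rule compact_imp_bounded)
  ultimately show "f \<in> bcontfun"
    by (simp add: bcontfun_def)
qed

text \<open>
  Since \<^typ>\<open>nat\<close> is discrete, \<^typ>\<open>nat \<Rightarrow>\<^sub>C real\<close> is \<open>\<ell>\<^sub>\<infinity>\<close>; \<open>c\<^sub>0\<close> is taken as a
  subspace of it and inherits the supremum norm.
\<close>

definition c0 :: "(nat \<Rightarrow>\<^sub>C real) set"
  where "c0 = {x. (\<lambda>n. apply_bcontfun x n) \<longlonglongrightarrow> 0}"

definition isomorphic_subspaces ::
    "'a::real_normed_vector set \<Rightarrow> 'b::real_normed_vector set \<Rightarrow> bool"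
  where "isomorphic_subspaces Z W \<longleftrightarrow>
    (\<exists>\<phi> \<psi>. homeomorphism Z W \<phi> \<psi> \<and>
      (\<forall>x\<in>Z. \<forall>y\<in>Z. \<phi> (x + y) = \<phi> x + \<phi> y) \<and>
      (\<forall>c. \<forall>x\<in>Z. \<phi> (c *\<^sub>R x) = c *\<^sub>R \<phi> x))"


section \<open>Normed spaces with explicit carrier\<close>

text \<open>
  A quotient \<open>X/Z\<close> depends on the term \<open>Z\<close>, so it is not a type; the Daugavet property
  is therefore defined for normed spaces given by a carrier set and operations.
\<close>

record 'a nspace =
  ns_carrier :: "'a set"
  ns_zero :: 'a
  ns_add :: "'a \<Rightarrow> 'a \<Rightarrow> 'a"
  ns_scale :: "real \<Rightarrow> 'a \<Rightarrow> 'a"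
  ns_norm :: "'a \<Rightarrow> real"

definition is_normed_space :: "'a nspace \<Rightarrow> bool"
  where "is_normed_space N \<longleftrightarrow>
    ns_zero N \<in> ns_carrier N \<and>
    (\<forall>x\<in>ns_carrier N. \<forall>y\<in>ns_carrier N. ns_add N x y \<in> ns_carrier N) \<and>
    (\<forall>a. \<forall>x\<in>ns_carrier N. ns_scale N a x \<in> ns_carrier N) \<and>
    (\<forall>x\<in>ns_carrier N. \<forall>y\<in>ns_carrier N. \<forall>z\<in>ns_carrier N.
      ns_add N (ns_add N x y) z = ns_add N x (ns_add N y z)) \<and>
    (\<forall>x\<in>ns_carrier N. \<forall>y\<in>ns_carrier N. ns_add N x y = ns_add N y x) \<and>
    (\<forall>x\<in>ns_carrier N. ns_add N (ns_zero N) x = x) \<and>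
    (\<forall>x\<in>ns_carrier N. ns_add N x (ns_scale N (-1) x) = ns_zero N) \<and>
    (\<forall>a. \<forall>x\<in>ns_carrier N. \<forall>y\<in>ns_carrier N.
      ns_scale N a (ns_add N x y) = ns_add N (ns_scale N a x) (ns_scale N a y)) \<and>
    (\<forall>a b. \<forall>x\<in>ns_carrier N.
      ns_scale N (a + b) x = ns_add N (ns_scale N a x) (ns_scale N b x)) \<and>
    (\<forall>a b. \<forall>x\<in>ns_carrier N. ns_scale N a (ns_scale N b x) = ns_scale N (a * b) x) \<and>
    (\<forall>x\<in>ns_carrier N. ns_scale N 1 x = x) \<and>
    (\<forall>x\<in>ns_carrier N. 0 \<le> ns_norm N x) \<and>
    (\<forall>x\<in>ns_carrier N. ns_norm N x = 0 \<longleftrightarrow> x = ns_zero N) \<and>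
    (\<forall>a. \<forall>x\<in>ns_carrier N. ns_norm N (ns_scale N a x) = \<bar>a\<bar> * ns_norm N x) \<and>
    (\<forall>x\<in>ns_carrier N. \<forall>y\<in>ns_carrier N.
      ns_norm N (ns_add N x y) \<le> ns_norm N x + ns_norm N y)"

definition bounded_operator :: "'a nspace \<Rightarrow> ('a \<Rightarrow> 'a) \<Rightarrow> bool"
  where "bounded_operator N T \<longleftrightarrow>
    (\<forall>x\<in>ns_carrier N. T x \<in> ns_carrier N) \<and>
    (\<forall>x\<in>ns_carrier N. \<forall>y\<in>ns_carrier N. T (ns_add N x y) = ns_add N (T x) (T y)) \<and>
    (\<forall>a. \<forall>x\<in>ns_carrier N. T (ns_scale N a x) = ns_scale N a (T x)) \<and>
    (\<exists>K. \<forall>x\<in>ns_carrier N. ns_norm N (T x) \<le> K * ns_norm N x)"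

definition operator_norm :: "'a nspace \<Rightarrow> ('a \<Rightarrow> 'a) \<Rightarrow> real"
  where "operator_norm N T = (SUP x\<in>{x \<in> ns_carrier N. ns_norm N x \<le> 1}. ns_norm N (T x))"

definition rank_one :: "'a nspace \<Rightarrow> ('a \<Rightarrow> 'a) \<Rightarrow> bool"
  where "rank_one N T \<longleftrightarrow>
    (\<exists>y\<in>ns_carrier N. y \<noteq> ns_zero N \<and> T ` ns_carrier N = range (\<lambda>a. ns_scale N a y))"

definition daugavet_property :: "'a nspace \<Rightarrow> bool"
  where "daugavet_property N \<longleftrightarrow>
    (\<forall>T. bounded_operator N T \<and> rank_one N T \<longrightarrow>
      operator_norm N (\<lambda>x. ns_add N x (T x)) = 1 + operator_norm N T)"


section \<open>Quotients and poor subspaces\<close>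

text \<open>
  In \<open>ns_scale\<close> the summand \<open>z\<close> matters only for \<open>a = 0\<close>, where plain pointwise scaling
  of a coset would give \<open>{0}\<close> instead of \<open>Z\<close>.
\<close>

definition quotient_space :: "'a::real_normed_vector set \<Rightarrow> 'a set nspace"
  where "quotient_space Z =
    \<lparr> ns_carrier = range (\<lambda>x. (+) x ` Z),
      ns_zero = Z,
      ns_add = (\<lambda>A B. {u + v | u v. u \<in> A \<and> v \<in> B}),
      ns_scale = (\<lambda>a A. {a *\<^sub>R u + z | u z. u \<in> A \<and> z \<in> Z}),
      ns_norm = (\<lambda>A. INF u\<in>A. norm u) \<rparr>"

definition poor :: "'a::real_normed_vector set \<Rightarrow> bool"
  where "poor Z \<longleftrightarrow> subspace Z \<and> closed Z \<and>
    (\<forall>W. subspace W \<and> closed W \<and> W \<subseteq> Z \<longrightarrow> daugavet_property (quotient_space W))"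

context
  fixes Z :: "'a::real_normed_vector set"
  assumes Z: "subspace Z"
begin

lemma quotient_add_coset:
  "ns_add (quotient_space Z) ((+) x ` Z) ((+) y ` Z) = (+) (x + y) ` Z"
proof (intro equalityI subsetI)
  fix w assume "w \<in> ns_add (quotient_space Z) ((+) x ` Z) ((+) y ` Z)"
  then obtain a b where ab: "a \<in> Z" "b \<in> Z" "w = x + a + (y + b)"
    by (auto simp: quotient_space_def)
  then have "w = x + y + (a + b)" "a + b \<in> Z"
    using Z by (auto intro: subspace_add)
  then show "w \<in> (+) (x + y) ` Z" by blast
next
  fix w assume "w \<in> (+) (x + y) ` Z"
  then obtain b where "b \<in> Z" "w = (x + 0) + (y + b)" by (auto simp: algebra_simps)
  then show "w \<in> ns_add (quotient_space Z) ((+) x ` Z) ((+) y ` Z)"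
    using subspace_0[OF Z] by (auto simp: quotient_space_def intro!: exI)
qed

lemma quotient_scale_coset:
  "ns_scale (quotient_space Z) a ((+) x ` Z) = (+) (a *\<^sub>R x) ` Z"
proof (intro equalityI subsetI)
  fix w assume "w \<in> ns_scale (quotient_space Z) a ((+) x ` Z)"
  then obtain u z where uz: "u \<in> Z" "z \<in> Z" "w = a *\<^sub>R (x + u) + z"
    by (auto simp: quotient_space_def)
  then have "w = a *\<^sub>R x + (a *\<^sub>R u + z)" "a *\<^sub>R u + z \<in> Z"
    using Z by (auto simp: scaleR_add_right intro: subspace_add subspace_scale)
  then show "w \<in> (+) (a *\<^sub>R x) ` Z" by blast
next
  fix w assume "w \<in> (+) (a *\<^sub>R x) ` Z"
  then obtain z where "z \<in> Z" "w = a *\<^sub>R (x + 0) + z" by auto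
  then show "w \<in> ns_scale (quotient_space Z) a ((+) x ` Z)"
    using subspace_0[OF Z] by (force simp: quotient_space_def)
qed

lemma quotient_norm_coset: "ns_norm (quotient_space Z) ((+) x ` Z) = infdist x Z"
proof -
  have "(\<lambda>z. norm (x + z)) ` Z = dist x ` Z"
  proof (intro equalityI subsetI)
    fix r assume "r \<in> (\<lambda>z. norm (x + z)) ` Z"
    then obtain z where z: "z \<in> Z" "r = norm (x + z)" by blast
    then have "- z \<in> Z" "r = dist x (- z)"
      using Z by (auto simp: dist_norm subspace_neg)
    then show "r \<in> dist x ` Z" by blast
  next
    fix r assume "r \<in> dist x ` Z"
    then obtain z where z: "z \<in> Z" "r = dist x z" by blast
    then have "- z \<in> Z" "r = norm (x + - z)"
      using Z by (auto simp: dist_norm subspace_neg)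
    then show "r \<in> (\<lambda>z. norm (x + z)) ` Z" by blast
  qed
  then show ?thesis
    using subspace_0[OF Z] by (auto simp: quotient_space_def infdist_def image_image)
qed

lemma coset_eq_subspace_iff: "(+) x ` Z = Z \<longleftrightarrow> x \<in> Z"
proof
  assume "(+) x ` Z = Z"
  then have "x + 0 \<in> Z" using subspace_0[OF Z] by blast
  then show "x \<in> Z" by simp
next
  assume x: "x \<in> Z"
  have "z \<in> (+) x ` Z" if "z \<in> Z" for z
    using that x subspace_diff[OF Z] by (intro image_eqI[of _ _ "z - x"]) auto
  then show "(+) x ` Z = Z"
    using x subspace_add[OF Z] by auto
qed

lemma quotient_is_normed_space:
  assumes "closed Z"
  shows "is_normed_space (quotient_space Z)"
proof -
  let ?Q = "quotient_space Z"
  have car: "ns_carrier ?Q = range (\<lambda>x. (+) x ` Z)" and zero: "ns_zero ?Q = Z"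
    by (simp_all add: quotient_space_def)
  have Z0: "Z = (+) 0 ` Z" by simp
  have ne: "Z \<noteq> {}" using subspace_0[OF Z] by auto
  have near: "\<exists>z\<in>Z. norm (x - z) < infdist x Z + e" if "e > 0" for x e
  proof -
    have "(INF z\<in>Z. dist x z) < infdist x Z + e"
      using that ne by (simp add: infdist_def)
    moreover have "bdd_below (dist x ` Z)"
      by (auto intro!: bdd_belowI[of _ 0])
    ultimately show ?thesis
      using cINF_less_iff[OF ne, of "dist x"] by (auto simp: dist_norm)
  qed
  have tri: "infdist (x + y) Z \<le> infdist x Z + infdist y Z" for x y
  proof (rule field_le_epsilon)
    fix e :: real assume "e > 0"
    then obtain u v where uv: "u \<in> Z" "norm (x - u) < infdist x Z + e/2"
      "v \<in> Z" "norm (y - v) < infdist y Z + e/2"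
      using near[of "e/2"] by (meson half_gt_zero)
    have "infdist (x + y) Z \<le> dist (x + y) (u + v)"
      using uv subspace_add[OF Z] by (intro infdist_le) auto
    also have "\<dots> \<le> norm (x - u) + norm (y - v)"
      using norm_triangle_ineq[of "x - u" "y - v"] by (simp add: dist_norm algebra_simps)
    finally show "infdist (x + y) Z \<le> infdist x Z + infdist y Z + e"
      using uv by simp
  qed
  have scale_le: "infdist (a *\<^sub>R x) Z \<le> \<bar>a\<bar> * infdist x Z" for a x
  proof (cases "a = 0")
    case True
    then show ?thesis using subspace_0[OF Z] by simp
  next
    case False
    show ?thesis
    proof (rule field_le_epsilon)
      fix e :: real assume "e > 0"
      then obtain u where u: "u \<in> Z" "norm (x - u) < infdist x Z + e / \<bar>a\<bar>"
        using near[of "e / \<bar>a\<bar>"] False by auto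
      have "infdist (a *\<^sub>R x) Z \<le> dist (a *\<^sub>R x) (a *\<^sub>R u)"
        using u subspace_scale[OF Z] by (intro infdist_le) auto
      also have "\<dots> = \<bar>a\<bar> * norm (x - u)"
        by (simp add: dist_norm flip: scaleR_diff_right)
      also have "\<dots> \<le> \<bar>a\<bar> * (infdist x Z + e / \<bar>a\<bar>)"
        using u by (intro mult_left_mono) auto
      finally show "infdist (a *\<^sub>R x) Z \<le> \<bar>a\<bar> * infdist x Z + e"
        using False by (simp add: distrib_left)
    qed
  qed
  have scale: "infdist (a *\<^sub>R x) Z = \<bar>a\<bar> * infdist x Z" for a x
  proof (cases "a = 0")
    case True
    then show ?thesis using subspace_0[OF Z] by simp
  next
    case False
    have "\<bar>a\<bar> * infdist x Z \<le> \<bar>a\<bar> * (\<bar>inverse a\<bar> * infdist (a *\<^sub>R x) Z)"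
      using scale_le[of "inverse a" "a *\<^sub>R x"] False by (intro mult_left_mono) auto
    also have "\<dots> = infdist (a *\<^sub>R x) Z"
      using False by (simp add: abs_inverse)
    finally show ?thesis
      using scale_le[of a x] by linarith
  qed
  have zero_iff: "infdist x Z = 0 \<longleftrightarrow> (+) x ` Z = Z" for x
    using in_closed_iff_infdist_zero[OF assms ne] coset_eq_subspace_iff by simp
  define q where "q x = (+) x ` Z" for x
  have q: "ns_carrier ?Q = range q" "ns_zero ?Q = q 0"
    "\<And>x y. ns_add ?Q (q x) (q y) = q (x + y)"
    "\<And>a x. ns_scale ?Q a (q x) = q (a *\<^sub>R x)"
    "\<And>x. ns_norm ?Q (q x) = infdist x Z"
    "\<And>x. infdist x Z = 0 \<longleftrightarrow> q x = q 0"
    unfolding q_def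
    by (simp_all add: car zero zero_iff quotient_add_coset quotient_scale_coset
        quotient_norm_coset)
  show ?thesis
    unfolding is_normed_space_def q(1,2)
    by (simp add: q(3-6) scale tri infdist_nonneg scaleR_add_left scaleR_add_right add.assoc)
       (simp add: add.commute)
qed

end

end

theory Submission
  imports Defs
begin

text \<open>
  Let \<open>W\<close> consist of the functions on \<open>[0,1]\<close> that vanish at \<open>0\<close> and, in the variable
  \<open>s = 1/t - 1\<close>, are affine between consecutive integers. The values at the nodes
  \<open>t = 1/(n+1)\<close> identify \<open>W\<close> isometrically with \<open>c\<^sub>0\<close>. On \<open>C[0,1]/W\<close> consider the
  rank-one operator \<open>T[y] = -y(0)[1]\<close>, which has norm \<open>1\<close>. Modulo \<open>W\<close>, the function
  \<open>y - y(0)\<close> equals \<open>y - y(0) h\<close> for \<open>h \<in> 1 + W\<close> with \<open>0 \<le> h \<le> 1 = h(0)\<close> and support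
  arbitrarily close to \<open>0\<close>, where \<open>y\<close> is almost \<open>y(0)\<close>; hence \<open>\<parallel>Id + T\<parallel> \<le> 1 < 1 + \<parallel>T\<parallel>\<close>.
\<close>

section \<open>Point evaluations and the coordinate \<open>s = 1/t - 1\<close> on the unit
  interval\<close>

lemma continuous_on_bcontfun_eval:
  fixes t :: "'a::topological_space"
  shows "continuous_on S (\<lambda>f :: 'a \<Rightarrow>\<^sub>C 'b::metric_space. apply_bcontfun f t)"
  unfolding continuous_on_iff by (meson dist_fun_lt_imp_dist_val_lt)

definition origin :: unit_interval
  where "origin = ui_of_real 0"

text \<open>Inverse of the coordinate \<open>s = 1/t - 1\<close>: \<open>s = 0\<close> is the right
  end point \<open>t = 1\<close>, and \<open>s\<close> tending to infinity approaches
  \<open>origin\<close>.\<close>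

definition pt :: "real \<Rightarrow> unit_interval"
  where "pt s = ui_of_real (1 / (1 + s))"

lemma real_of_ui_origin [simp]: "real_of_ui origin = 0"
  by (simp add: origin_def ui_of_real_inverse)

lemma real_of_ui_pt [simp]: "0 \<le> s \<Longrightarrow> real_of_ui (pt s) = 1 / (1 + s)"
  by (simp add: pt_def ui_of_real_inverse)

text \<open>Away from \<open>origin\<close>, \<open>n\<close> is the integer part of
  \<open>s = 1/t - 1\<close> and \<open>r\<close> the remainder. This is the shape to which the
  affine condition in \<open>W\<close> applies.\<close>

lemma unit_interval_cases:
  obtains "t = origin" | n r where "0 \<le> r" "r \<le> 1" "t = pt (real n + r)"
proof (cases "real_of_ui t = 0")
  case True
  then have "t = origin"
    using real_of_ui_origin real_of_ui_inject by metis
  then show ?thesis by (rule that(1))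
next
  case False
  define s where "s = 1 / real_of_ui t - 1"
  have "0 \<le> real_of_ui t" "real_of_ui t \<le> 1"
    using real_of_ui[of t] by auto
  then have s: "0 \<le> s" "real_of_ui t = 1 / (1 + s)"
    using False by (auto simp: s_def field_simps)
  define n where "n = nat \<lfloor>s\<rfloor>"
  have "real n = of_int \<lfloor>s\<rfloor>"
    using s by (simp add: n_def)
  then have "0 \<le> s - real n" "s - real n \<le> 1"
    by linarith+
  moreover have "t = pt (real n + (s - real n))"
    using s real_of_ui_inverse[of t] by (simp add: pt_def)
  ultimately show ?thesis by (rule that(2))
qed

lemma pt_tendsto_origin: "(\<lambda>n. pt (real n)) \<longlonglongrightarrow> origin"
proof -
  have "(\<lambda>n. dist (pt (real n)) origin) = (\<lambda>n. inverse (real (Suc n)))"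
    by (auto simp: dist_unit_interval_def field_simps)
  then show ?thesis
    using LIMSEQ_inverse_real_of_nat tendsto_dist_iff by metis
qed

section \<open>The closed subspace \<open>W\<close>\<close>

definition W :: "C01 set"
  where "W = {f. apply_bcontfun f origin = 0 \<and> (\<forall>n::nat. \<forall>r\<in>{0..1}.
    apply_bcontfun f (pt (real n + r)) =
      (1 - r) * apply_bcontfun f (pt (real n)) + r * apply_bcontfun f (pt (real (Suc n))))}"

lemma subspace_W: "subspace W"
proof (rule subspaceI)
  fix f g assume "f \<in> W" "g \<in> W"
  then show "f + g \<in> W" by (auto simp: W_def algebra_simps)
next
  fix c f assume "f \<in> W"
  then show "c *\<^sub>R f \<in> W" by (auto simp: W_def distrib_left mult.left_commute)
qed (simp add: W_def)

lemma closed_W: "closed W"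
proof -
  have "W = {f. apply_bcontfun f origin = 0} \<inter> (\<Inter>n. \<Inter>r\<in>{0..1}.
    {f. apply_bcontfun f (pt (real n + r)) =
      (1 - r) * apply_bcontfun f (pt (real n)) + r * apply_bcontfun f (pt (real (Suc n)))})"
    by (auto simp: W_def)
  also have "closed \<dots>"
    by (intro closed_Int closed_INT ballI closed_Collect_eq continuous_intros
        continuous_on_bcontfun_eval)
  finally show ?thesis .
qed

text \<open>Away from \<open>origin\<close>, where \<open>f\<close> vanishes, each value of
  \<open>f\<close> is a convex combination of two neighbouring node values.\<close>

lemma norm_W_le:
  assumes "f \<in> W" and nodes: "\<And>n::nat. \<bar>apply_bcontfun f (pt (real n))\<bar> \<le> c"
  shows "norm f \<le> c"
proof (rule norm_bound)
  fix t
  have "0 \<le> c" using nodes[of 0] by linarith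
  show "norm (apply_bcontfun f t) \<le> c"
  proof (cases t rule: unit_interval_cases)
    case 1
    then show ?thesis using assms(1) \<open>0 \<le> c\<close> by (simp add: W_def)
  next
    case (2 n r)
    then have "apply_bcontfun f t =
        (1 - r) * apply_bcontfun f (pt (real n)) + r * apply_bcontfun f (pt (real (Suc n)))"
      using assms(1) by (auto simp: W_def)
    also have "\<bar>\<dots>\<bar> \<le> (1 - r) * \<bar>apply_bcontfun f (pt (real n))\<bar>
        + r * \<bar>apply_bcontfun f (pt (real (Suc n)))\<bar>"
      using 2 by (intro order.trans[OF abs_triangle_ineq]) (simp add: abs_mult)
    also have "\<dots> \<le> (1 - r) * c + r * c"
      using 2 nodes by (intro add_mono mult_left_mono) (auto simp del: of_nat_Suc)
    finally show ?thesis by (simp add: algebra_simps)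
  qed
qed

section \<open>Ramp functions, the building blocks of \<open>W\<close>\<close>

text \<open>
  The inner \<open>max\<close> only changes points where the outer one gives \<open>0\<close>; it removes the
  singularity of \<open>1/t\<close> and its junk value at \<open>t = 0\<close>.
\<close>

definition ramp :: "nat \<Rightarrow> C01"
  where "ramp n = Bcontfun (\<lambda>t.
    max 0 (min 1 (real n + 1 - 1 / max (real_of_ui t) (1 / (real n + 2)))))"

lemma ramp_apply: "apply_bcontfun (ramp n) t =
    max 0 (min 1 (real n + 1 - 1 / max (real_of_ui t) (1 / (real n + 2))))"
proof -
  have "1 / (real n + 2) > 0" by simp
  then have "max x (1 / (real n + 2)) \<noteq> 0" for x :: real
    by linarith
  then have "continuous_on UNIV (\<lambda>t.
      max 0 (min 1 (real n + 1 - 1 / max (real_of_ui t) (1 / (real n + 2)))))"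
    by (intro continuous_intros continuous_on_real_of_ui) auto
  then have "(\<lambda>t. max 0 (min 1 (real n + 1 - 1 / max (real_of_ui t) (1 / (real n + 2)))))
      \<in> bcontfun"
    by (rule bcontfun_normI[where b = 1]) auto
  then show ?thesis by (simp add: ramp_def Bcontfun_inverse)
qed

text \<open>In the coordinate \<open>s\<close> the ramp is \<open>1\<close> up to
  \<open>n - 1\<close>, falls with slope \<open>-1\<close>, and is \<open>0\<close> from
  \<open>n\<close> on; for \<open>n = 0\<close> it is the zero function.\<close>

lemma ramp_pt:
  assumes "0 \<le> s"
  shows "apply_bcontfun (ramp n) (pt s) = max 0 (min 1 (real n - s))"
proof (cases "s \<le> real n + 1")
  case True
  then have "max (1 / (1 + s)) (1 / (real n + 2)) = 1 / (1 + s)"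
    using assms by (intro max_absorb1 divide_left_mono) auto
  then show ?thesis using assms by (simp add: ramp_apply)
next
  case False
  then have "max (1 / (1 + s)) (1 / (real n + 2)) = 1 / (real n + 2)"
    using assms by (intro max_absorb2 divide_left_mono) auto
  then show ?thesis using assms False by (simp add: ramp_apply)
qed

lemma ramp_origin [simp]: "apply_bcontfun (ramp n) origin = 0"
  by (simp add: ramp_apply max_absorb2)

lemma ramp_node: "apply_bcontfun (ramp n) (pt (real k)) = (if k < n then 1 else 0)"
  by (auto simp: ramp_pt)

lemma ramp_bounds: "0 \<le> apply_bcontfun (ramp n) t" "apply_bcontfun (ramp n) t \<le> 1"
  by (auto simp: ramp_apply)

text \<open>Hence \<open>1 - ramp n\<close>, which serves as the function \<open>h\<close> of the
  overview, lives on \<open>t < 1/n\<close>.\<close>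

lemma ramp_eq_1:
  assumes "0 < n" "1 / real n \<le> real_of_ui t"
  shows "apply_bcontfun (ramp n) t = 1"
proof -
  have "1 / (real n + 2) \<le> 1 / real n"
    using assms by (intro divide_left_mono) auto
  then have "max (real_of_ui t) (1 / (real n + 2)) = real_of_ui t"
    using assms by linarith
  moreover have "1 / real_of_ui t \<le> real n"
    using assms by (smt (verit) divide_pos_pos mult.commute of_nat_0_less_iff pos_divide_le_eq)
  ultimately show ?thesis by (simp add: ramp_apply)
qed

lemma ramp_in_W: "ramp n \<in> W"
proof -
  have "apply_bcontfun (ramp n) (pt (real k + r)) =
      (1 - r) * apply_bcontfun (ramp n) (pt (real k)) +
      r * apply_bcontfun (ramp n) (pt (real (Suc k)))" if "r \<in> {0..1}" for k r
  proof -
    \<comment> \<open>On the piece from \<open>k\<close> to \<open>k + 1\<close> the ramp is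
      constantly \<open>0\<close>, falls from \<open>1\<close> to \<open>0\<close>, or is constantly
      \<open>1\<close>; its kinks are at integers.\<close>
    consider "n \<le> k" | "n = Suc k" | "real k + 2 \<le> real n" by linarith
    then show ?thesis
      using that unfolding ramp_node by cases (auto simp: ramp_pt)
  qed
  then show ?thesis by (simp add: W_def)
qed

section \<open>Interpolation of null sequences\<close>

definition partial_sum :: "(nat \<Rightarrow> real) \<Rightarrow> nat \<Rightarrow> C01"
  where "partial_sum a N = (\<Sum>n<N. a n *\<^sub>R (ramp (Suc n) - ramp n))"

lemma partial_sum_in_W: "partial_sum a N \<in> W"
  unfolding partial_sum_def
  by (intro subspace_sum subspace_scale subspace_diff subspace_W ramp_in_W)

text \<open>The summand \<open>ramp (Suc n) - ramp n\<close> is the hat function with value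
  \<open>1\<close> at node \<open>n\<close> and \<open>0\<close> at all other nodes.\<close>

lemma partial_sum_node:
  "apply_bcontfun (partial_sum a N) (pt (real k)) = (if k < N then a k else 0)"
proof (induction N)
  case 0
  then show ?case by (simp add: partial_sum_def)
next
  case (Suc N)
  have "partial_sum a (Suc N) = partial_sum a N + a N *\<^sub>R (ramp (Suc N) - ramp N)"
    by (simp add: partial_sum_def)
  then show ?case
    using Suc by (auto simp: ramp_node less_Suc_eq)
qed

text \<open>By \<open>norm_W_le\<close> the norm on \<open>W\<close> is controlled by node values,
  so small tails of \<open>a\<close> make the partial sums Cauchy. Their limit stays in the closed
  set \<open>W\<close>.\<close>

lemma interpolation_exists:
  assumes a: "a \<longlonglongrightarrow> 0"
  obtains f where "f \<in> W" "\<And>n. apply_bcontfun f (pt (real n)) = a n"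
proof -
  have "Cauchy (partial_sum a)"
  proof (rule metric_CauchyI)
    fix e :: real assume "0 < e"
    then obtain M where M: "\<And>n. M \<le> n \<Longrightarrow> \<bar>a n\<bar> < e / 2"
      using LIMSEQ_D[OF a, of "e / 2"] by auto
    have "dist (partial_sum a m) (partial_sum a n) < e" if "M \<le> m" "M \<le> n" for m n
    proof -
      have "norm (partial_sum a m - partial_sum a n) \<le> e / 2"
      proof (rule norm_W_le)
        show "partial_sum a m - partial_sum a n \<in> W"
          by (intro subspace_diff subspace_W partial_sum_in_W)
        \<comment> \<open>The difference is \<open>0\<close> at node \<open>k\<close> unless
          \<open>k\<close> lies between \<open>m\<close> and \<open>n\<close>; there it is
          \<open>a k\<close> up to sign, with \<open>M \<le> k\<close>.\<close>
        show "\<bar>apply_bcontfun (partial_sum a m - partial_sum a n) (pt (real k))\<bar> \<le> e / 2" for k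
          using M[of k] that \<open>0 < e\<close> by (auto simp: partial_sum_node)
      qed
      then show ?thesis using \<open>0 < e\<close> by (simp add: dist_norm)
    qed
    then show "\<exists>M. \<forall>m\<ge>M. \<forall>n\<ge>M. dist (partial_sum a m) (partial_sum a n) < e" by blast
  qed
  then obtain f where f: "partial_sum a \<longlonglongrightarrow> f"
    using Cauchy_convergent convergent_def by blast
  show ?thesis
  proof
    show "f \<in> W"
      using closed_sequentially[OF closed_W _ f] partial_sum_in_W by blast
    fix n
    have "(\<lambda>N. apply_bcontfun (partial_sum a N) (pt (real n))) \<longlonglongrightarrow> apply_bcontfun f (pt (real n))"
      using continuous_on_tendsto_compose[OF continuous_on_bcontfun_eval[of UNIV] f] by simp
    moreover have "(\<lambda>N. apply_bcontfun (partial_sum a N) (pt (real n))) \<longlonglongrightarrow> a n"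
      by (rule tendsto_eventually)
        (auto simp: partial_sum_node eventually_sequentially intro!: exI[of _ "Suc n"])
    ultimately show "apply_bcontfun f (pt (real n)) = a n"
      by (rule LIMSEQ_unique)
  qed
qed

section \<open>The isometry between \<open>W\<close> and \<open>c0\<close>\<close>

lemma isomorphic_subspaces_isometry:
  assumes "subspace Z" "bij_betw \<phi> Z V"
    and add: "\<And>x y. x \<in> Z \<Longrightarrow> y \<in> Z \<Longrightarrow> \<phi> (x + y) = \<phi> x + \<phi> y"
    and scale: "\<And>c x. x \<in> Z \<Longrightarrow> \<phi> (c *\<^sub>R x) = c *\<^sub>R \<phi> x"
    and norm: "\<And>x. x \<in> Z \<Longrightarrow> norm (\<phi> x) = norm x"
  shows "isomorphic_subspaces Z V"
proof -
  \<comment> \<open>Preserved distances give continuity of \<open>\<phi>\<close> and of its inverse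
    at once.\<close>
  have dist: "dist (\<phi> x) (\<phi> y) = dist x y" if "x \<in> Z" "y \<in> Z" for x y
  proof -
    have "\<phi> (x - y) = \<phi> x - \<phi> y"
      using add[of x "(-1) *\<^sub>R y"] scale[of y "-1"] that subspace_scale[OF assms(1), of y "-1"]
      by simp
    then show ?thesis
      using norm[of "x - y"] that subspace_diff[OF assms(1)] by (simp add: dist_norm)
  qed
  have inv: "inv_into Z \<phi> v \<in> Z" "\<phi> (inv_into Z \<phi> v) = v" if "v \<in> V" for v
    using that assms(2) by (auto simp: bij_betw_def inv_into_into f_inv_into_f)
  have "homeomorphism Z V \<phi> (inv_into Z \<phi>)"
  proof (rule homeomorphismI)
    show "continuous_on Z \<phi>"
      unfolding continuous_on_iff using dist by auto
    show "continuous_on V (inv_into Z \<phi>)"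
      unfolding continuous_on_iff using dist inv by metis
  qed (use assms(2) inv in \<open>auto simp: bij_betw_def\<close>)
  then show ?thesis
    unfolding isomorphic_subspaces_def using add scale by blast
qed

definition node_values :: "C01 \<Rightarrow> (nat \<Rightarrow>\<^sub>C real)"
  where "node_values f = Bcontfun (\<lambda>n. apply_bcontfun f (pt (real n)))"

lemma node_values_apply [simp]:
  "apply_bcontfun (node_values f) = (\<lambda>n. apply_bcontfun f (pt (real n)))"
proof -
  have "(\<lambda>n. apply_bcontfun f (pt (real n))) \<in> bcontfun"
    by (rule bcontfun_normI[OF _ norm_bounded]) simp
  then show ?thesis by (simp add: node_values_def Bcontfun_inverse)
qed

text \<open>Node values form a null sequence because the nodes tend to \<open>origin\<close>, where
  \<open>f\<close> vanishes; \<open>interpolation_exists\<close> gives surjectivity and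
  \<open>norm_W_le\<close> the isometry.\<close>

lemma isomorphic_W_c0: "isomorphic_subspaces W c0"
proof (rule isomorphic_subspaces_isometry)
  show "norm (node_values f) = norm f" if "f \<in> W" for f
  proof (rule antisym)
    show "norm (node_values f) \<le> norm f"
      by (rule norm_bound) (use norm_bounded[of f] in simp)
    show "norm f \<le> norm (node_values f)"
      using that by (rule norm_W_le) (use norm_bounded[of "node_values f"] in simp)
  qed
  show "bij_betw node_values W c0"
    unfolding bij_betw_def
  proof
    show "inj_on node_values W"
    proof (rule inj_onI)
      fix f g assume fg: "f \<in> W" "g \<in> W" "node_values f = node_values g"
      then have "apply_bcontfun f (pt (real n)) = apply_bcontfun g (pt (real n))" for n
        using fun_cong[OF node_values_apply] by metis
      then have "norm (f - g) \<le> 0"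
        using fg by (intro norm_W_le subspace_diff subspace_W) auto
      then show "f = g" by simp
    qed
    show "node_values ` W = c0"
    proof (intro equalityI subsetI)
      fix x assume "x \<in> node_values ` W"
      then obtain f where f: "f \<in> W" "x = node_values f" by blast
      have "(\<lambda>n. apply_bcontfun f (pt (real n))) \<longlonglongrightarrow> apply_bcontfun f origin"
        by (rule continuous_on_tendsto_compose[OF continuous_on_apply_bcontfun[of UNIV]
              pt_tendsto_origin]) auto
      then show "x \<in> c0" using f by (simp add: c0_def W_def)
    next
      fix x assume "x \<in> c0"
      then have "apply_bcontfun x \<longlonglongrightarrow> 0" by (simp add: c0_def)
      then obtain f where "f \<in> W" "\<And>n. apply_bcontfun f (pt (real n)) = apply_bcontfun x n"
        using interpolation_exists by blast
      then have "f \<in> W" "x = node_values f" by (auto intro: bcontfun_eqI)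
      then show "x \<in> node_values ` W" by blast
    qed
  qed
qed (auto simp: subspace_W intro: bcontfun_eqI)

section \<open>Distances to \<open>W\<close>, that is, norms in the quotient\<close>

abbreviation coset :: "C01 \<Rightarrow> C01 set"
  where "coset y \<equiv> (+) y ` W"

lemma infdist_W_near:
  assumes "infdist y W < c"
  obtains w where "w \<in> W" "norm (y - w) < c"
proof -
  have "W \<noteq> {}" using subspace_0[OF subspace_W] by auto
  moreover have "bdd_below (dist y ` W)"
    by (rule bdd_belowI2[of _ 0]) simp
  ultimately have "\<exists>w\<in>W. dist y w < c"
    using assms cINF_less_iff[of W "dist y" c] by (simp add: infdist_def)
  then show ?thesis
    using that by (auto simp: dist_norm)
qed

text \<open>Members of \<open>W\<close> vanish at \<open>origin\<close>, so subtracting one leaves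
  the value there unchanged.\<close>

lemma abs_eval_origin_le_infdist: "\<bar>apply_bcontfun y origin\<bar> \<le> infdist y W"
proof (rule ccontr)
  assume "\<not> ?thesis"
  then obtain w where w: "w \<in> W" "norm (y - w) < \<bar>apply_bcontfun y origin\<bar>"
    using infdist_W_near[of y "\<bar>apply_bcontfun y origin\<bar>"] not_le by blast
  then show False
    using norm_bounded[of "y - w" origin] by (simp add: W_def)
qed

lemma infdist_const: "infdist (const_bcontfun c) W = \<bar>c\<bar>"
proof (rule antisym)
  have "infdist (const_bcontfun c) W \<le> dist (const_bcontfun c) (0 :: C01)"
    by (rule infdist_le[OF subspace_0[OF subspace_W]])
  also have "\<dots> \<le> \<bar>c\<bar>"
    by (simp add: norm_bound)
  finally show "infdist (const_bcontfun c) W \<le> \<bar>c\<bar>" .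
  show "\<bar>c\<bar> \<le> infdist (const_bcontfun c) W"
    using abs_eval_origin_le_infdist[of "const_bcontfun c"] by simp
qed

text \<open>The key estimate. Modulo \<open>W\<close> the constant \<open>c\<close> may be replaced
  by \<open>c * h\<close> with \<open>h = 1 - ramp n\<close>, and \<open>v - c * h\<close> is the
  convex combination of \<open>v - c\<close> and \<open>v\<close> with weights \<open>h\<close> and
  \<open>1 - h\<close>. Near \<open>origin\<close>, \<open>v - c\<close> is small; elsewhere
  \<open>h = 0\<close>.\<close>

lemma infdist_minus_eval_origin_le:
  "infdist (y - const_bcontfun (apply_bcontfun y origin)) W \<le> infdist y W"
proof (rule field_le_epsilon)
  fix e :: real assume "0 < e"
  define c where "c = apply_bcontfun y origin"
  obtain w where w: "w \<in> W" "norm (y - w) < infdist y W + e / 2"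
    using infdist_W_near[of y "infdist y W + e / 2"] \<open>0 < e\<close> by auto
  \<comment> \<open>An almost norm-minimal representative of the class of \<open>y\<close>, with the
    same value at \<open>origin\<close>.\<close>
  define v where "v = y - w"
  have v0: "apply_bcontfun v origin = c"
    using w by (simp add: v_def c_def W_def)
  obtain d where d: "d > 0" "\<And>t. dist t origin < d \<Longrightarrow> \<bar>apply_bcontfun v t - c\<bar> < e / 2"
    using continuous_on_apply_bcontfun[of UNIV v] v0 \<open>0 < e\<close>
    unfolding continuous_on_iff dist_real_def by (metis UNIV_I half_gt_zero)
  \<comment> \<open>Then \<open>h\<close> vanishes outside the \<open>d\<close>-neighbourhood of
    \<open>origin\<close> where \<open>v\<close> is close to \<open>c\<close>.\<close>
  obtain n where n: "0 < n" "1 / real n < d"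
    using d(1) by (metis inverse_eq_divide reals_Archimedean zero_less_Suc)
  define h where "h t = 1 - apply_bcontfun (ramp n) t" for t
  have h: "0 \<le> h t" "h t \<le> 1" for t
    using ramp_bounds[of n t] by (auto simp: h_def)
  have "norm (v - const_bcontfun c + c *\<^sub>R ramp n) \<le> norm v + e / 2"
  proof (rule norm_bound)
    fix t
    have "\<bar>apply_bcontfun v t - c\<bar> * h t \<le> e / 2"
    proof (cases "h t = 0")
      case False
      then have "real_of_ui t < 1 / real n"
        using ramp_eq_1[OF n(1), of t] by (force simp: h_def)
      then have "dist t origin < d"
        using n(2) real_of_ui[of t] by (simp add: dist_unit_interval_def)
      then have "\<bar>apply_bcontfun v t - c\<bar> * h t \<le> e / 2 * 1"
        using d(2)[of t] h[of t] \<open>0 < e\<close> by (intro mult_mono) auto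
      then show ?thesis by simp
    qed (use \<open>0 < e\<close> in simp)
    moreover have "\<bar>apply_bcontfun v t\<bar> * (1 - h t) \<le> norm v * 1"
      using norm_bounded[of v t] h[of t] by (intro mult_mono) auto
    moreover have "apply_bcontfun (v - const_bcontfun c + c *\<^sub>R ramp n) t =
        (apply_bcontfun v t - c) * h t + apply_bcontfun v t * (1 - h t)"
      by (simp add: h_def algebra_simps)
    moreover have "\<bar>(apply_bcontfun v t - c) * h t + apply_bcontfun v t * (1 - h t)\<bar>
        \<le> \<bar>apply_bcontfun v t - c\<bar> * h t + \<bar>apply_bcontfun v t\<bar> * (1 - h t)"
      using h[of t] by (intro order.trans[OF abs_triangle_ineq]) (simp add: abs_mult)
    ultimately show "norm (apply_bcontfun (v - const_bcontfun c + c *\<^sub>R ramp n) t)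
        \<le> norm v + e / 2"
      by simp
  qed
  \<comment> \<open>The element \<open>w - c * ramp n\<close> of \<open>W\<close> turns
    \<open>y - c\<close> into \<open>v - c * h\<close>.\<close>
  moreover have "infdist (y - const_bcontfun c) W \<le> dist (y - const_bcontfun c) (w - c *\<^sub>R ramp n)"
    using w by (intro infdist_le subspace_diff subspace_scale subspace_W ramp_in_W)
  moreover have "dist (y - const_bcontfun c) (w - c *\<^sub>R ramp n) =
      norm (v - const_bcontfun c + c *\<^sub>R ramp n)"
    by (simp add: dist_norm v_def algebra_simps)
  ultimately show "infdist (y - const_bcontfun (apply_bcontfun y origin)) W \<le> infdist y W + e"
    using w by (simp add: c_def v_def)
qed

section \<open>The rank-one operator on the quotient\<close>

definition coset_eval :: "C01 set \<Rightarrow> real"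
  where "coset_eval A = apply_bcontfun (SOME u. u \<in> A) origin"

text \<open>The chosen representative does not matter: any two differ by an element of
  \<open>W\<close>, which is \<open>0\<close> at \<open>origin\<close>.\<close>

lemma coset_eval_coset [simp]: "coset_eval (coset y) = apply_bcontfun y origin"
proof -
  have "y + 0 \<in> coset y"
    using subspace_0[OF subspace_W] by blast
  then have "(SOME u. u \<in> coset y) \<in> coset y"
    by (rule someI)
  then show ?thesis
    unfolding coset_eval_def by (auto simp: W_def)
qed

definition neg_eval :: "C01 set \<Rightarrow> C01 set"
  where "neg_eval A = coset (const_bcontfun (- coset_eval A))"

lemma quotient_W_simps:
  "ns_carrier (quotient_space W) = range coset"
  "ns_add (quotient_space W) (coset x) (coset y) = coset (x + y)"
  "ns_scale (quotient_space W) a (coset x) = coset (a *\<^sub>R x)"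
  "ns_norm (quotient_space W) (coset x) = infdist x W"
  by (simp_all only: quotient_add_coset[OF subspace_W] quotient_scale_coset[OF subspace_W]
      quotient_norm_coset[OF subspace_W]) (simp add: quotient_space_def)

lemma neg_eval_coset: "neg_eval (coset y) = coset (const_bcontfun (- apply_bcontfun y origin))"
  by (simp only: neg_eval_def coset_eval_coset)

lemma const_bcontfun_add: "const_bcontfun (a + b :: real) = const_bcontfun a + const_bcontfun b"
  and const_bcontfun_scaleR: "const_bcontfun (c * a) = c *\<^sub>R const_bcontfun a"
  by (auto intro!: bcontfun_eqI)

lemma bounded_operator_neg_eval: "bounded_operator (quotient_space W) neg_eval"
  unfolding bounded_operator_def quotient_W_simps(1)
proof (intro conjI ballI allI exI[of _ 1]; elim imageE; hypsubst;
    unfold quotient_W_simps neg_eval_coset)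
  fix x y :: C01 and a :: real
  show "coset (const_bcontfun (- apply_bcontfun x origin)) \<in> range coset" by blast
  show "coset (const_bcontfun (- apply_bcontfun (x + y) origin)) =
      coset (const_bcontfun (- apply_bcontfun x origin) + const_bcontfun (- apply_bcontfun y origin))"
    by (simp only: const_bcontfun_add[symmetric]) simp
  show "coset (const_bcontfun (- apply_bcontfun (a *\<^sub>R x) origin)) =
      coset (a *\<^sub>R const_bcontfun (- apply_bcontfun x origin))"
    by (simp only: const_bcontfun_scaleR[symmetric]) simp
  show "infdist (const_bcontfun (- apply_bcontfun x origin)) W \<le> 1 * infdist x W"
    using abs_eval_origin_le_infdist[of x] by (simp add: infdist_const)
qed

lemma rank_one_neg_eval: "rank_one (quotient_space W) neg_eval"
proof -
  have "const_bcontfun 1 \<notin> W"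
    by (simp add: W_def)
  then have "coset (const_bcontfun 1) \<noteq> ns_zero (quotient_space W)"
    using coset_eq_subspace_iff[OF subspace_W] by (simp add: quotient_space_def)
  moreover have "neg_eval ` range coset =
      range (\<lambda>a. ns_scale (quotient_space W) a (coset (const_bcontfun 1)))"
  proof -
    \<comment> \<open>Constants already realise every value at \<open>origin\<close>, so the image
      is the full line through the class of \<open>1\<close>.\<close>
    have "range (\<lambda>y :: C01. - apply_bcontfun y origin) = UNIV"
      by (rule surjI[of _ "\<lambda>a. const_bcontfun (- a)"]) simp
    then have "range (\<lambda>y :: C01. coset (const_bcontfun (- apply_bcontfun y origin))) =
        range (\<lambda>a. coset (const_bcontfun a))"
      using image_image[of "\<lambda>a. coset (const_bcontfun a)" "\<lambda>y. - apply_bcontfun y origin" UNIV]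
      by simp
    moreover have "ns_scale (quotient_space W) a (coset (const_bcontfun 1)) =
        coset (const_bcontfun a)" for a
      unfolding quotient_W_simps const_bcontfun_scaleR[symmetric] by simp
    ultimately show ?thesis
      by (simp only: image_image neg_eval_coset)
  qed
  ultimately show ?thesis
    unfolding rank_one_def quotient_W_simps(1) by blast
qed

lemma operator_norm_neg_eval: "1 \<le> operator_norm (quotient_space W) neg_eval"
proof -
  let ?Q = "quotient_space W"
  let ?B = "{x \<in> ns_carrier ?Q. ns_norm ?Q x \<le> 1}"
  have "ns_norm ?Q (neg_eval x) \<le> 1" if x: "x \<in> ?B" for x
  proof -
    obtain y where y: "x = coset y"
      using x unfolding quotient_W_simps(1) by blast
    have "infdist y W \<le> 1"
      using x unfolding y mem_Collect_eq quotient_W_simps(4) by blast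
    then show ?thesis
      unfolding y neg_eval_coset quotient_W_simps(4)
      using abs_eval_origin_le_infdist[of y] by (simp add: infdist_const)
  qed
  \<comment> \<open>Boundedness comes first: only then does the real supremum dominate the value at
    the test class of \<open>1\<close>.\<close>
  then have "bdd_above ((\<lambda>x. ns_norm ?Q (neg_eval x)) ` ?B)"
    by (rule bdd_aboveI2)
  moreover have "coset (const_bcontfun 1) \<in> ?B"
    unfolding mem_Collect_eq quotient_W_simps(1,4) by (simp add: infdist_const)
  ultimately have "ns_norm ?Q (neg_eval (coset (const_bcontfun 1))) \<le> operator_norm ?Q neg_eval"
    unfolding operator_norm_def by (intro cSUP_upper)
  then show ?thesis
    unfolding neg_eval_coset quotient_W_simps(4) infdist_const
    by simp
qed

lemma operator_norm_id_plus_neg_eval: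
  "operator_norm (quotient_space W) (\<lambda>x. ns_add (quotient_space W) x (neg_eval x)) \<le> 1"
proof -
  let ?Q = "quotient_space W"
  let ?B = "{x \<in> ns_carrier ?Q. ns_norm ?Q x \<le> 1}"
  \<comment> \<open>The zero class makes the supremum range over a nonempty set; writing it with a
    constant lets \<open>infdist_const\<close> compute its norm.\<close>
  have "coset (const_bcontfun 0) \<in> ?B"
    unfolding mem_Collect_eq quotient_W_simps(1,4) infdist_const by (auto simp del: const_bcontfun_0_eq_0)
  moreover have "ns_norm ?Q (ns_add ?Q x (neg_eval x)) \<le> 1" if x: "x \<in> ?B" for x
  proof -
    obtain y where y: "x = coset y"
      using x unfolding quotient_W_simps(1) by blast
    have "infdist y W \<le> 1"
      using x unfolding y mem_Collect_eq quotient_W_simps(4) by blast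
    moreover have "y + const_bcontfun (- apply_bcontfun y origin) =
        y - const_bcontfun (apply_bcontfun y origin)"
      by (auto intro: bcontfun_eqI)
    ultimately show ?thesis
      unfolding y neg_eval_coset quotient_W_simps(2,4)
      using infdist_minus_eval_origin_le[of y] by simp
  qed
  ultimately show ?thesis
    unfolding operator_norm_def by (intro cSUP_least) auto
qed

text \<open>The Daugavet equation would put a number at most \<open>1\<close> equal to one at least
  \<open>2\<close>. Taking \<open>W\<close> as a closed subspace of itself then refutes
  \<open>poor W\<close>.\<close>

lemma not_daugavet_quotient_W: "\<not> daugavet_property (quotient_space W)"
proof
  assume "daugavet_property (quotient_space W)"
  then have "operator_norm (quotient_space W) (\<lambda>x. ns_add (quotient_space W) x (neg_eval x)) =
      1 + operator_norm (quotient_space W) neg_eval"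
    unfolding daugavet_property_def using bounded_operator_neg_eval rank_one_neg_eval by blast
  then show False
    using operator_norm_neg_eval operator_norm_id_plus_neg_eval by linarith
qed

theorem corollary3p3:
  shows "\<exists>Z :: C01 set. subspace Z \<and> closed Z \<and> isomorphic_subspaces Z c0 \<and> \<not> poor Z"
  using subspace_W closed_W isomorphic_W_c0 not_daugavet_quotient_W
  unfolding poor_def by blast

end
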